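(* There is an absolute constant $c>0$ such that for every $n$ and every $\varepsilon\in(0,1)$, any sketch $\mathrm{sk}(A)$ of a general $n\times n$ matrix $A$ that satisfies the ``for each'' guarantee with relative approximation $\varepsilon$ and with probability $0.9$, even when all entries of $A$ are promised to be in the set $\{0,1\}$, must use at least $c\,n^2$ bits of space.
   Context: A sketch consists of a (possibly randomized) map $A\mapsto\mathrm{sk}(A)$ to bit strings and an estimation procedure $\mathrm{est}$ that sees only the query $x\in\mathbb R^n$ and $\mathrm{sk}(A)$ (and possibly shared random bits). It satisfies the ``for each'' guarantee with relative approximation $\varepsilon$ and probability $p$ if for every admissible $A$ and every fixed $x\in\mathbb R^n$, with probability at least $p$, the estimate $\mathrm{est}(x,\mathrm{sk}(A))$ lies in $(1\pm\varepsilon)x^TAx$, i.e. between $(1-\varepsilon)x^TAx$ and $(1+\varepsilon)x^TAx$. The space is the worst-case length of $\mathrm{sk}(A)$ over admissible $A$ and random choices. *)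

theory Defs
  imports "HOL-Probability.Probability_Measure" "Jordan_Normal_Form.Matrix"
begin

definition quad_form :: "real mat \<Rightarrow> real vec \<Rightarrow> real" where
  "quad_form A x = scalar_prod x (A *\<^sub>v x)"

definition binary_mats :: "nat \<Rightarrow> real mat set" where
  "binary_mats n = {A \<in> carrier_mat n n. \<forall>i<n. \<forall>j<n. A $$ (i, j) \<in> {0, 1}}"

text \<open>
  A randomized sketch is given by a probability space \<open>M\<close> of random choices, a sketching map
  \<open>sk\<close> and an estimator \<open>est\<close>. The outcome \<open>\<omega>\<close> comprises all random choices and is passed to both
  \<open>sk\<close> and \<open>est\<close>, i.e. all randomness may be shared; private coins of either side are the case
  where the other side ignores the corresponding part of \<open>\<omega>\<close>.

  For a general matrix the quadratic form may be negative, in which case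
  \<open>(1 + \<epsilon>) * q < (1 - \<epsilon>) * q\<close>; the closed segment is the set of reals between the two
  values regardless of their order. If the success event were not measurable, its \<open>measure\<close>
  would be 0, so for \<open>p > 0\<close> its measurability is part of the guarantee.
\<close>

definition for_each_guarantee ::
  "'w measure \<Rightarrow> ('w \<Rightarrow> real mat \<Rightarrow> bool list) \<Rightarrow> ('w \<Rightarrow> real vec \<Rightarrow> bool list \<Rightarrow> real)
    \<Rightarrow> nat \<Rightarrow> real mat set \<Rightarrow> real \<Rightarrow> real \<Rightarrow> bool" where
  "for_each_guarantee M sk est n \<A> \<epsilon> p \<longleftrightarrow>
     (\<forall>A\<in>\<A>. \<forall>x\<in>carrier_vec n.
        measure M {\<omega> \<in> space M. est \<omega> x (sk \<omega> A) \<in>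
          closed_segment ((1 - \<epsilon>) * quad_form A x) ((1 + \<epsilon>) * quad_form A x)} \<ge> p)"

text \<open>The value is \<open>\<infinity>\<close> if the sketch length is unbounded.\<close>

definition sketch_space ::
  "'w measure \<Rightarrow> ('w \<Rightarrow> real mat \<Rightarrow> bool list) \<Rightarrow> real mat set \<Rightarrow> ereal" where
  "sketch_space M sk \<A> = (SUP A\<in>\<A>. SUP \<omega>\<in>space M. ereal (real (length (sk \<omega> A))))"

text \<open>
  Random choices are infinite sequences of bits, under an arbitrary probability law (and
  sigma-algebra), in particular not necessarily independent or fair. The type is fixed, rather than
  left polymorphic, because a constant whose existence is asserted in a polymorphic
  theorem could depend on the type variable and would not be absolute.
\<close>

type_synonym random_bits = "nat \<Rightarrow> bool"

end

theory Submission imports Defs begin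

text \<open>
  A set \<open>T\<close> of positions below the diagonal is encoded as its indicator matrix. The quadratic form
  at \<open>e\<^sub>i + e\<^sub>j\<close> is then 1 or 0 according to whether \<open>(i, j) \<in> T\<close>, and every relative approximation
  tells 0 from nonzero, so each of the \<open>N = n(n - 1)/2\<close> bits is recovered with probability 0.9. Averaging
  over \<open>T\<close> and the positions fixes one outcome of the random choices for which the average
  number of wrong bits is at most \<open>N/10\<close>. With \<open>d T\<close> the number of wrong bits for \<open>T\<close>, the sum of
  \<open>exp (- d T)\<close> over all \<open>T\<close> is at least \<open>2^N * exp (- N/10)\<close> by convexity. It is at most
  \<open>(1 + exp (- 1))^N\<close> times the number of sketch values, of which there are at most \<open>4^L\<close> if sketches
  have length at most \<open>L\<close>. Hence \<open>N \<le> 8 L\<close>.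
\<close>

text \<open>By linearity, the number of events that contain a random outcome has expectation at
  least \<open>p * card I\<close>, and some outcome reaches the mean. This serves to fix the shared
  randomness.\<close>

lemma (in prob_space) exists_outcome_in_average_many_events:
  assumes "finite I" and E: "\<And>i. i \<in> I \<Longrightarrow> E i \<in> events"
    and p: "\<And>i. i \<in> I \<Longrightarrow> p \<le> prob (E i)"
  shows "\<exists>\<omega>\<in>space M. p * real (card I) \<le> real (card {i\<in>I. \<omega> \<in> E i})"
proof (rule ccontr)
  define f where "f \<omega> = (\<Sum>i\<in>I. indicator (E i) \<omega> :: real)" for \<omega>
  have card_eq: "real (card {i\<in>I. \<omega> \<in> E i}) = f \<omega>" for \<omega>
  proof -
    have "real (card {i\<in>I. \<omega> \<in> E i}) = (\<Sum>i\<in>{i\<in>I. \<omega> \<in> E i}. 1)"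
      by simp
    also have "\<dots> = f \<omega>"
      unfolding f_def indicator_def of_bool_def
      using assms(1) by (intro sum.mono_neutral_cong_left) auto
    finally show ?thesis .
  qed
  assume "\<not> ?thesis"
  then have less: "f \<omega> < p * real (card I)" if "\<omega> \<in> space M" for \<omega>
    using that card_eq by (auto simp: not_le)
  have int: "integrable M f"
    unfolding f_def using E by (intro Bochner_Integration.integrable_sum) (simp add: less_top[symmetric])
  have "expectation f < p * real (card I)"
    by (rule expectation_less) (use int less in auto)
  moreover have "expectation f = (\<Sum>i\<in>I. prob (E i))"
    unfolding f_def using E by (subst Bochner_Integration.integral_sum) (auto simp: less_top[symmetric])
  moreover have "(\<Sum>i\<in>I. prob (E i)) \<ge> (\<Sum>i\<in>I. p)"
    by (intro sum_mono p)
  ultimately show False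
    by (simp add: mult.commute)
qed

text \<open>Each element of \<open>S\<close> contributes a factor 1 or \<open>z\<close> on its own,
  according to whether \<open>T\<close> agrees with \<open>U\<close> there. The sum is therefore the
  same for every centre \<open>U\<close>.\<close>

lemma sum_Pow_power_hamming_distance:
  fixes z :: "'b::comm_semiring_1"
  assumes "finite S"
  shows "(\<Sum>T\<in>Pow S. z ^ card {s\<in>S. (s \<in> T) \<noteq> (s \<in> U)}) = (1 + z) ^ card S"
  using assms
proof (induction S rule: finite_induct)
  case (insert a S)
  let ?h = "\<lambda>S T. z ^ card {s\<in>S. (s \<in> T) \<noteq> (s \<in> U)}"
  have *: "?h (insert a S) T = (if (a \<in> T) \<noteq> (a \<in> U) then z else 1) * ?h S (T - {a})" for T
  proof -
    have "{s\<in>insert a S. (s \<in> T) \<noteq> (s \<in> U)} =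
        (if (a \<in> T) \<noteq> (a \<in> U) then insert a else id) {s\<in>S. (s \<in> T - {a}) \<noteq> (s \<in> U)}"
      using insert.hyps by auto
    then show ?thesis
      using insert.hyps by simp
  qed
  have inj: "inj_on (insert a) (Pow S)"
    using insert.hyps by (auto simp: inj_on_def)
  have "(\<Sum>T\<in>Pow (insert a S). ?h (insert a S) T) =
      (\<Sum>T\<in>Pow S. ?h (insert a S) T) + (\<Sum>T\<in>Pow S. ?h (insert a S) (insert a T))"
    using insert.hyps inj
    by (subst Pow_insert, subst sum.union_disjoint) (auto simp: sum.reindex)
  also have "\<dots> = (\<Sum>T\<in>Pow S. (if a \<in> U then z else 1) * ?h S T)
      + (\<Sum>T\<in>Pow S. (if a \<in> U then 1 else z) * ?h S T)"
  proof (intro arg_cong2[where f = "(+)"] sum.cong refl)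
    fix T assume "T \<in> Pow S"
    then have "a \<notin> T"
      using insert.hyps by auto
    then show "?h (insert a S) T = (if a \<in> U then z else 1) * ?h S T"
      and "?h (insert a S) (insert a T) = (if a \<in> U then 1 else z) * ?h S T"
      unfolding * by simp_all
  qed
  also have "\<dots> = (1 + z) * (1 + z) ^ card S"
    unfolding sum_distrib_left[symmetric] insert.IH by (simp add: algebra_simps)
  finally show ?case
    using insert.hyps by simp
qed simp

lemma card_bool_lists_length_le:
  "finite {xs :: bool list. length xs \<le> L}" "card {xs :: bool list. length xs \<le> L} \<le> 4 ^ L"
proof -
  have eq: "{xs :: bool list. length xs \<le> L} = {xs. set xs \<subseteq> UNIV \<and> length xs \<le> L}"
    by simp
  show "finite {xs :: bool list. length xs \<le> L}"
    unfolding eq by (rule finite_lists_length_le) simp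
  \<comment> \<open>The exact value is \<open>2 ^ (L + 1) - 1\<close>. A pure power of 4 avoids an
    additive constant in the final bound on \<open>card S\<close>.\<close>
  have "(\<Sum>i\<le>L. 2 ^ i) \<le> (4 :: nat) ^ L"
  proof (induction L)
    case (Suc L)
    have "(2::nat) ^ L \<le> 4 ^ L"
      by (rule power_mono) auto
    with Suc show ?case
      by simp
  qed simp
  then show "card {xs :: bool list. length xs \<le> L} \<le> 4 ^ L"
    unfolding eq by (subst card_lists_length_le) (simp_all add: card_UNIV_bool)
qed

text \<open>Decoding may err, so \<open>code\<close> need not be injective. Instead, each list can
  serve only the few sets near its decoded value; the weight \<open>z ^ d T U\<close> measures this
  without a binomial tail bound.\<close>

lemma code_length_ge_of_average_recovery:
  fixes code :: "'a set \<Rightarrow> bool list" and dec :: "bool list \<Rightarrow> 'a set"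
  assumes "finite S" and len: "\<And>T. T \<subseteq> S \<Longrightarrow> length (code T) \<le> L"
    and rec: "0.9 * real (card S) * 2 ^ card S \<le>
      (\<Sum>T\<in>Pow S. real (card {s\<in>S. (s \<in> T) = (s \<in> dec (code T))}))"
  shows "card S \<le> 8 * L"
proof -
  define N where "N = card S"
  define d where "d T U = card {s\<in>S. (s \<in> T) \<noteq> (s \<in> U)}" for T U :: "'a set"
  define e where "e T = d T (dec (code T))" for T
  define B where "B = {xs :: bool list. length xs \<le> L}"
  define z where "z = exp (-1 :: real)"
  have finB: "finite B" and cardB: "real (card B) \<le> 4 ^ L"
    using card_bool_lists_length_le(1)[of L] of_nat_mono[OF card_bool_lists_length_le(2)[of L], where 'a = real]
    by (simp_all add: B_def)
  have z: "0 < z" "z \<le> 1/2"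
    using exp_ge_add_one_self[of 1] by (auto simp: z_def exp_minus field_simps)
  have zpow: "z ^ k = exp (- real k)" for k
    by (simp add: z_def flip: exp_of_nat_mult)
  have "real (card {s\<in>S. (s \<in> T) = (s \<in> dec (code T))}) + real (e T) = real N" for T
  proof -
    have "S = {s\<in>S. (s \<in> T) = (s \<in> dec (code T))} \<union> {s\<in>S. (s \<in> T) \<noteq> (s \<in> dec (code T))}"
      by auto
    then have "N = card ({s\<in>S. (s \<in> T) = (s \<in> dec (code T))} \<union> {s\<in>S. (s \<in> T) \<noteq> (s \<in> dec (code T))})"
      unfolding N_def by (rule arg_cong)
    also have "\<dots> = card {s\<in>S. (s \<in> T) = (s \<in> dec (code T))} + e T"
      unfolding e_def d_def using assms(1) by (subst card_Un_disjoint) auto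
    finally show ?thesis by simp
  qed
  then have "(\<Sum>T\<in>Pow S. real (card {s\<in>S. (s \<in> T) = (s \<in> dec (code T))})) = (\<Sum>T\<in>Pow S. real N - real (e T))"
    by (intro sum.cong refl) (simp add: eq_diff_eq)
  also have "\<dots> = 2 ^ N * real N - (\<Sum>T\<in>Pow S. real (e T))"
    using assms(1) by (simp add: sum_subtractf card_Pow N_def)
  finally have err: "(\<Sum>T\<in>Pow S. real (e T)) \<le> 2 ^ N * (real N / 10)"
    using rec unfolding N_def by (simp add: mult.commute)
  \<comment> \<open>The tangent to \<open>exp\<close> at the average error replaces Jensen's inequality.\<close>
  have "2 ^ N * exp (- real N / 10) \<le> (\<Sum>T\<in>Pow S. exp (- real N / 10) * (1 + (real N / 10 - real (e T))))"
  proof -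
    have "(\<Sum>T\<in>Pow S. 1 + (real N / 10 - real (e T))) \<ge> 2 ^ N"
      using err assms(1) by (simp add: sum.distrib sum_subtractf card_Pow N_def)
    then show ?thesis
      by (simp add: sum_distrib_left[symmetric] mult.commute)
  qed
  also have "\<dots> \<le> (\<Sum>T\<in>Pow S. z ^ e T)"
  proof (rule sum_mono)
    fix T
    have "exp (- real N / 10) * (1 + (real N / 10 - real (e T)))
        \<le> exp (- real N / 10) * exp (real N / 10 - real (e T))"
      by (intro mult_left_mono exp_ge_add_one_self) auto
    also have "\<dots> = z ^ e T"
      by (simp add: zpow flip: exp_add)
    finally show "exp (- real N / 10) * (1 + (real N / 10 - real (e T))) \<le> z ^ e T" .
  qed
  \<comment> \<open>The left side is the summand for \<open>xs = code T\<close>. Adding the other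
    lists makes the centre \<open>dec xs\<close> independent of \<open>T\<close>, so the sums can be
    swapped.\<close>
  also have "\<dots> \<le> (\<Sum>T\<in>Pow S. \<Sum>xs\<in>B. z ^ d T (dec xs))"
  proof (rule sum_mono)
    fix T assume "T \<in> Pow S"
    then show "z ^ e T \<le> (\<Sum>xs\<in>B. z ^ d T (dec xs))"
      unfolding e_def using finB len z by (intro member_le_sum) (auto simp: B_def)
  qed
  also have "\<dots> = real (card B) * (1 + z) ^ N"
    unfolding d_def N_def
    by (subst sum.swap, unfold sum_Pow_power_hamming_distance[OF assms(1)]) simp
  also have "\<dots> \<le> 4 ^ L * (3/2) ^ N"
    using cardB z by (intro mult_mono power_mono) auto
  finally have main: "2 ^ N * exp (- real N / 10) \<le> 4 ^ L * (3/2) ^ N" .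
  have "(9/10) ^ N \<le> exp (- real N / 10)"
  proof -
    have "(9/10) ^ N \<le> exp (- 1/10 :: real) ^ N"
      using exp_ge_add_one_self[of "- 1/10"] by (intro power_mono) auto
    also have "\<dots> = exp (- real N / 10)"
      by (simp flip: exp_of_nat_mult)
    finally show ?thesis .
  qed
  then have "2 ^ N * (9/10) ^ N \<le> 4 ^ L * (3/2 :: real) ^ N"
    using main by (smt (verit) mult_left_mono zero_le_power)
  \<comment> \<open>\<open>2 * 9/10 = 6/5 * 3/2\<close>.\<close>
  then have "(6/5) ^ N * (3/2) ^ N \<le> 4 ^ L * (3/2 :: real) ^ N"
    by (simp flip: power_mult_distrib)
  then have "(6/5) ^ N \<le> (4 :: real) ^ L"
    by (simp add: mult_le_cancel_right)
  \<comment> \<open>8 is the least exponent \<open>k\<close> with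
    \<open>(6/5) ^ k >= 4\<close>.\<close>
  then have "((6/5) ^ N) ^ 8 \<le> ((4 :: real) ^ L) ^ 8"
    by (rule power_mono) simp
  also have "\<dots> = 4 ^ (8 * L)"
    by (simp only: power_mult[symmetric] mult.commute)
  finally have "((6/5 :: real) ^ 8) ^ N \<le> 4 ^ (8 * L)"
    by (simp only: power_mult[symmetric] mult.commute)
  moreover have "(4 :: real) ^ N \<le> ((6/5) ^ 8) ^ N"
    by (rule power_mono) (simp_all add: field_simps)
  ultimately have "(4 :: real) ^ N \<le> 4 ^ (8 * L)"
    by (rule order_trans[rotated])
  then show ?thesis
    by (simp add: N_def)
qed

lemma quad_form_indicator:
  "quad_form (mat n n (\<lambda>p. of_bool (p \<in> T))) (vec n (\<lambda>k. of_bool (k \<in> R)))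
    = real (card (T \<inter> (R \<inter> {..<n}) \<times> (R \<inter> {..<n})))"
proof -
  let ?R = "R \<inter> {..<n}"
  have "quad_form (mat n n (\<lambda>p. of_bool (p \<in> T))) (vec n (\<lambda>k. of_bool (k \<in> R)))
      = (\<Sum>i<n. of_bool (i \<in> R) * (\<Sum>j<n. of_bool ((i, j) \<in> T) * of_bool (j \<in> R)))"
    unfolding quad_form_def scalar_prod_def dim_mult_mat_vec dim_row_mat atLeast0LessThan
    by (intro sum.cong refl) (simp add: scalar_prod_def atLeast0LessThan)
  also have "\<dots> = (\<Sum>i<n. \<Sum>j<n. of_bool ((i, j) \<in> T \<inter> ?R \<times> ?R))"
    unfolding sum_distrib_left by (intro sum.cong refl) (auto split: split_of_bool)
  also have "\<dots> = (\<Sum>p\<in>{..<n} \<times> {..<n}. of_bool (p \<in> T \<inter> ?R \<times> ?R))"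
    by (simp only: sum.cartesian_product case_prod_unfold prod.collapse)
  also have "\<dots> = (\<Sum>p\<in>T \<inter> ?R \<times> ?R. 1)"
    by (intro sum.mono_neutral_cong_right) auto
  finally show ?thesis
    by simp
qed

text \<open>The query for \<open>(i, j)\<close> also sees the positions \<open>(j, i)\<close>,
  \<open>(i, i)\<close> and \<open>(j, j)\<close>. By \<open>sep\<close> none of these other than
  \<open>(i, j)\<close> itself lies in \<open>S\<close>, so the query reads a single bit.\<close>

lemma card_le_sketch_space:
  assumes eps: "0 < \<epsilon>" "\<epsilon> < 1" and "prob_space M"
    and guar: "for_each_guarantee M sk est n (binary_mats n) \<epsilon> 0.9"
    and S: "S \<subseteq> {..<n} \<times> {..<n}"
    and sep: "\<And>i j. (i, j) \<in> S \<Longrightarrow> S \<inter> {i, j} \<times> {i, j} = {(i, j)}"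
  shows "ereal (real (card S) / 8) \<le> sketch_space M sk (binary_mats n)"
proof -
  interpret prob_space M by fact
  have finS: "finite S"
    using S by (rule finite_subset) auto
  define A :: "(nat \<times> nat) set \<Rightarrow> real mat" where "A T = mat n n (\<lambda>p. of_bool (p \<in> T))" for T
  \<comment> \<open>As an indicator of a set, this is a unit vector at a diagonal position, so the
    form is 0 or 1 there too.\<close>
  define x :: "nat \<times> nat \<Rightarrow> real vec" where "x s = vec n (\<lambda>k. of_bool (k \<in> {fst s, snd s}))" for s
  have A: "A T \<in> binary_mats n" for T
    by (auto simp: A_def binary_mats_def)
  have x: "x s \<in> carrier_vec n" for s
    by (simp add: x_def)
  have quad: "quad_form (A T) (x s) = of_bool (s \<in> T)" if "s \<in> S" "T \<subseteq> S" for s T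
  proof -
    obtain i j where s: "s = (i, j)"
      by (cases s)
    then have "{i, j} \<inter> {..<n} = {i, j}"
      using that S by auto
    moreover have "T \<inter> {i, j} \<times> {i, j} = T \<inter> {(i, j)}"
      using sep[of i j] that s by blast
    ultimately show ?thesis
      unfolding A_def x_def using quad_form_indicator[of n T "{i, j}"] by (auto simp: s)
  qed
  define E where "E = (\<lambda>(T, s). {\<omega> \<in> space M. est \<omega> (x s) (sk \<omega> (A T)) \<in>
    closed_segment ((1 - \<epsilon>) * quad_form (A T) (x s)) ((1 + \<epsilon>) * quad_form (A T) (x s))})"
  have E: "0.9 \<le> prob (E q)" for q
    using guar A x by (auto simp: for_each_guarantee_def E_def split: prod.split)
  \<comment> \<open>A non-measurable set would have measure 0, below 0.9.\<close>
  have "E q \<in> events" for q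
    using E[of q] measure_notin_sets[of "E q" M] by fastforce
  then obtain \<omega> where \<omega>: "\<omega> \<in> space M"
    and many: "0.9 * real (card (Pow S \<times> S)) \<le> real (card {q \<in> Pow S \<times> S. \<omega> \<in> E q})"
    using exists_outcome_in_average_many_events[of "Pow S \<times> S" E "0.9"] E finS by auto
  define code where "code T = sk \<omega> (A T)" for T
  \<comment> \<open>The segment is \<open>{0}\<close> for a form of value 0, and avoids 0 for value
    1 because \<open>\<epsilon> < 1\<close>.\<close>
  define dec where "dec m = {s. est \<omega> (x s) m \<noteq> 0}" for m
  \<comment> \<open>Only finitely many sketches occur for the fixed outcome, so \<open>L\<close> is
    finite even if \<open>sketch_space\<close> is infinite.\<close>
  define L where "L = Max ((\<lambda>T. length (code T)) ` Pow S)"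
  have correct: "(s \<in> T) = (s \<in> dec (code T))" if "T \<subseteq> S" "s \<in> S" "\<omega> \<in> E (T, s)" for T s
    using that eps quad[of s T]
    by (cases "s \<in> T") (auto simp: E_def dec_def code_def closed_segment_eq_real_ivl split: if_splits)
  have "card {q \<in> Pow S \<times> S. \<omega> \<in> E q} \<le> card (SIGMA T:Pow S. {s\<in>S. (s \<in> T) = (s \<in> dec (code T))})"
    using finS by (intro card_mono) (auto intro!: finite_SigmaI simp: correct)
  also have "\<dots> = (\<Sum>T\<in>Pow S. card {s\<in>S. (s \<in> T) = (s \<in> dec (code T))})"
    using finS by (subst card_SigmaI) auto
  finally have "real (card {q \<in> Pow S \<times> S. \<omega> \<in> E q}) \<le>
      (\<Sum>T\<in>Pow S. real (card {s\<in>S. (s \<in> T) = (s \<in> dec (code T))}))"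
    unfolding of_nat_sum[symmetric] by (rule of_nat_mono)
  with many have "0.9 * real (card S) * 2 ^ card S \<le>
      (\<Sum>T\<in>Pow S. real (card {s\<in>S. (s \<in> T) = (s \<in> dec (code T))}))"
    using finS by (simp add: card_cartesian_product card_Pow mult_ac)
  then have "card S \<le> 8 * L"
    by (intro code_length_ge_of_average_recovery[OF finS]) (auto simp: L_def finS intro: Max_ge)
  moreover have "ereal (real L) \<le> sketch_space M sk (binary_mats n)"
  proof -
    have "L \<in> (\<lambda>T. length (code T)) ` Pow S"
      unfolding L_def using finS by (intro Max_in) auto
    then obtain T where "L = length (sk \<omega> (A T))"
      by (auto simp: code_def)
    then show ?thesis
      unfolding sketch_space_def using A \<omega> by (auto intro!: SUP_upper2)
  qed
  ultimately show ?thesis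
    by (elim order_trans[rotated]) simp
qed

theorem theoremA1:
  "\<exists>c::real. c > 0 \<and>
     (\<forall>(n::nat) (\<epsilon>::real) (M :: random_bits measure)
        (sk :: random_bits \<Rightarrow> real mat \<Rightarrow> bool list)
        (est :: random_bits \<Rightarrow> real vec \<Rightarrow> bool list \<Rightarrow> real).
        0 < \<epsilon> \<longrightarrow> \<epsilon> < 1 \<longrightarrow> prob_space M \<longrightarrow>
        for_each_guarantee M sk est n (binary_mats n) \<epsilon> 0.9 \<longrightarrow>
        ereal (c * (real n)\<^sup>2) \<le> sketch_space M sk (binary_mats n))"
\<comment> \<open>The factor 1/8 comes from the coding bound and 1/4 from
  \<open>n\<^sup>2 \<le> 4 * card S\<close>.\<close>
proof (intro exI[of _ "1/32"] conjI allI impI)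
  fix n :: nat and \<epsilon> :: real and M :: "random_bits measure"
    and sk :: "random_bits \<Rightarrow> real mat \<Rightarrow> bool list"
    and est :: "random_bits \<Rightarrow> real vec \<Rightarrow> bool list \<Rightarrow> real"
  assume *: "0 < \<epsilon>" "\<epsilon> < 1" "prob_space M" "for_each_guarantee M sk est n (binary_mats n) \<epsilon> 0.9"
  \<comment> \<open>Off-diagonal positions alone would give nothing for \<open>n = 1\<close>.\<close>
  define S where "S = (if n = 1 then {(0, 0)} else (SIGMA i:{..<n}. {..<i}))"
  have S: "S \<subseteq> {..<n} \<times> {..<n}"
    by (auto simp: S_def)
  have sep: "S \<inter> {i, j} \<times> {i, j} = {(i, j)}" if "(i, j) \<in> S" for i j
    using that by (auto simp: S_def split: if_splits)
  have "n\<^sup>2 \<le> 4 * card S"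
  proof (cases "n \<le> 1")
    case True
    then show ?thesis
      by (cases n) (auto simp: S_def)
  next
    case False
    have sum: "2 * (\<Sum>i<n. i) + n = n\<^sup>2"
      by (induction n) (auto simp: power2_eq_square)
    \<comment> \<open>Here \<open>4 * card S\<close> equals \<open>2 * n\<^sup>2 - 2 * n\<close>, so
      this is what remains to be shown.\<close>
    have "2 * n \<le> n\<^sup>2"
      using False by (simp add: power2_eq_square)
    with sum False show ?thesis
      by (simp add: S_def card_SigmaI)
  qed
  then have "(real n)\<^sup>2 \<le> 4 * real (card S)"
    using of_nat_mono[of "n\<^sup>2" "4 * card S", where 'a = real] by simp
  then have "ereal (1/32 * (real n)\<^sup>2) \<le> ereal (real (card S) / 8)"
    by simp
  also have "\<dots> \<le> sketch_space M sk (binary_mats n)"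
    by (rule card_le_sketch_space[OF * S sep])
  finally show "ereal (1/32 * (real n)\<^sup>2) \<le> sketch_space M sk (binary_mats n)" .
qed simp

end
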